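(* Let $n\ge 4$ and $r\ge 0$ be integers, and for $m\ge 4$ let $C_m^c$ be the complement of the cyclic graph on $[m]$. Then \[ \mathrm{Inc}(\mathbb{N})_{n,n+r}(I(C_n^c)) = I(C_{n+r}^c). \]
   Context: Let $k$ be a field, $R_m=k[x_1,\dots,x_m]$ and $[m]=\{1,\dots,m\}$. For $n\le m$, $\mathrm{Inc}(\mathbb{N})_{n,m}$ is the set of strictly increasing functions $\pi:[n]\to[m]$; each such $\pi$ induces the $k$-algebra homomorphism $\pi:R_n\to R_m$, $x_i\mapsto x_{\pi(i)}$. For an ideal $I\subseteq R_n$, $\mathrm{Inc}(\mathbb{N})_{n,m}(I):=\sum_{\pi\in\mathrm{Inc}(\mathbb{N})_{n,m}}\pi(I)R_m$, the ideal of $R_m$ generated by the images of $I$ under all such $\pi$. The edge ideal of a simple graph $G$ on $[n]$ is $I(G)=(x_ix_j : \{i,j\}\in E(G))\subseteq R_n$. For $m\ge 4$, $C_m^c$ is the complement of the cycle on $[m]$ with edges $\{i,i+1\}$ ($1\le i\le m-1$) and $\{1,m\}$; i.e. for $1\le i<j\le m$, $\{i,j\}$ is an edge of $C_m^c$ exactly when $2\le j-i\le m-2$. *)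

theory Defs
  imports "HOL-Library.Poly_Mapping" "HOL-Library.FuncSet" "HOL-Algebra.Ideal" "HOL-Algebra.RingHom"
begin

text \<open>
  Polynomials over \<open>'k\<close> in the variables \<open>x\<^sub>i\<close>, \<open>i :: nat\<close>: a finitely supported map from
  exponent vectors (themselves finitely supported) to coefficients. The ring \<open>R\<^sub>m\<close> consists of
  those polynomials in which only \<open>x\<^sub>1, \<dots>, x\<^sub>m\<close> occur.
\<close>

type_synonym 'k mpoly = "(nat \<Rightarrow>\<^sub>0 nat) \<Rightarrow>\<^sub>0 'k"

definition Var :: "nat \<Rightarrow> 'k::field mpoly" where
  "Var i = Poly_Mapping.single (Poly_Mapping.single i 1) 1"

definition Const :: "'k::field \<Rightarrow> 'k mpoly" where
  "Const c = Poly_Mapping.single 0 c"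

definition poly_ring :: "nat \<Rightarrow> 'k::field mpoly ring" where
  "poly_ring m =
    \<lparr>carrier = {p. \<forall>t\<in>Poly_Mapping.keys p. Poly_Mapping.keys t \<subseteq> {1..m}},
     mult = (*), one = 1, zero = 0, add = (+)\<rparr>"

definition Inc :: "nat \<Rightarrow> nat \<Rightarrow> (nat \<Rightarrow> nat) set" where
  "Inc n m = {\<pi> \<in> {1..n} \<rightarrow>\<^sub>E {1..m}. strict_mono_on {1..n} \<pi>}"

definition induced_hom :: "(nat \<Rightarrow> nat) \<Rightarrow> 'k::field mpoly \<Rightarrow> 'k mpoly" where
  "induced_hom \<pi> p =
    (\<Sum>t\<in>Poly_Mapping.keys p. Const (Poly_Mapping.lookup p t) *
       (\<Prod>i\<in>Poly_Mapping.keys t. Var (\<pi> i) ^ Poly_Mapping.lookup t i))"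

definition Inc_ideal :: "nat \<Rightarrow> nat \<Rightarrow> 'k::field mpoly set \<Rightarrow> 'k mpoly set" where
  "Inc_ideal n m I = Idl\<^bsub>poly_ring m\<^esub> (\<Union>\<pi>\<in>Inc n m. induced_hom \<pi> ` I)"

text \<open>A simple graph on \<open>{1..n}\<close> is given by its set of edges, which are two-element subsets.\<close>

definition edge_ideal :: "nat \<Rightarrow> nat set set \<Rightarrow> 'k::field mpoly set" where
  "edge_ideal n E = Idl\<^bsub>poly_ring n\<^esub> {Var i * Var j | i j. {i, j} \<in> E}"

definition cycle_edges :: "nat \<Rightarrow> nat set set" where
  "cycle_edges m = {{i, i + 1} | i. 1 \<le> i \<and> i \<le> m - 1} \<union> {{1, m}}"

definition complement_edges :: "nat \<Rightarrow> nat set set \<Rightarrow> nat set set" where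
  "complement_edges m E = {e. e \<subseteq> {1..m} \<and> card e = 2} - E"

definition cycle_complement :: "nat \<Rightarrow> nat set set" where
  "cycle_complement m = complement_edges m (cycle_edges m)"

lemma cycle_complement_iff:
  assumes "4 \<le> m" "1 \<le> i" "i < j" "j \<le> m"
  shows "{i, j} \<in> cycle_complement m \<longleftrightarrow> 2 \<le> j - i \<and> j - i \<le> m - 2"
  using assms unfolding cycle_complement_def complement_edges_def cycle_edges_def
  by (auto simp: doubleton_eq_iff)

text \<open>\<open>Idl\<close> is the expected ideal only over an actual ring.\<close>

lemma cring_poly_ring: "cring (poly_ring m :: 'k::field mpoly ring)"
proof (rule cringI)
  show "abelian_group (poly_ring m :: 'k mpoly ring)"
  proof (rule abelian_groupI)
    fix p :: "'k mpoly" assume p: "p \<in> carrier (poly_ring m)"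
    show "\<exists>q\<in>carrier (poly_ring m). q \<oplus>\<^bsub>poly_ring m\<^esub> p = \<zero>\<^bsub>poly_ring m\<^esub>"
      by (rule bexI [of _ "- p"]) (use p in \<open>auto simp: poly_ring_def in_keys_iff\<close>)
  qed (auto simp: poly_ring_def add_ac dest!: subsetD [OF keys_add])
  show "comm_monoid (poly_ring m :: 'k mpoly ring)"
  proof (rule comm_monoidI)
    fix p q :: "'k mpoly"
    assume pq: "p \<in> carrier (poly_ring m)" "q \<in> carrier (poly_ring m)"
    have "Poly_Mapping.keys t \<subseteq> {1..m}" if t: "t \<in> Poly_Mapping.keys (p * q)" for t
    proof -
      obtain a b where ab: "t = a + b" "a \<in> Poly_Mapping.keys p" "b \<in> Poly_Mapping.keys q"
        using subsetD [OF keys_mult t] by auto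
      have "Poly_Mapping.keys a \<subseteq> {1..m}" "Poly_Mapping.keys b \<subseteq> {1..m}"
        using ab pq by (auto simp: poly_ring_def)
      then show ?thesis
        using keys_add [of a b] ab(1) by blast
    qed
    then show "p \<otimes>\<^bsub>poly_ring m\<^esub> q \<in> carrier (poly_ring m)"
      by (simp add: poly_ring_def)
  qed (auto simp: poly_ring_def mult_ac)
qed (auto simp: poly_ring_def algebra_simps)

text \<open>\<open>induced_hom \<pi>\<close> is the \<open>'k\<close>-algebra homomorphism with \<open>x\<^sub>i \<mapsto> x\<^bsub>\<pi>(i)\<^esub>\<close>.\<close>

lemma induced_hom_superset:
  assumes "finite A" "Poly_Mapping.keys t \<subseteq> A"
  shows "(\<Prod>i\<in>Poly_Mapping.keys t. (Var (\<pi> i) :: 'k::field mpoly) ^ Poly_Mapping.lookup t i)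
    = (\<Prod>i\<in>A. Var (\<pi> i) ^ Poly_Mapping.lookup t i)"
  by (rule prod.mono_neutral_left) (use assms in \<open>auto simp: in_keys_iff\<close>)

lemma induced_hom_monom_add:
  "(\<Prod>i\<in>Poly_Mapping.keys (s + t). (Var (\<pi> i) :: 'k::field mpoly) ^ Poly_Mapping.lookup (s + t) i)
    = (\<Prod>i\<in>Poly_Mapping.keys s. Var (\<pi> i) ^ Poly_Mapping.lookup s i) *
      (\<Prod>i\<in>Poly_Mapping.keys t. Var (\<pi> i) ^ Poly_Mapping.lookup t i)"
proof -
  let ?A = "Poly_Mapping.keys s \<union> Poly_Mapping.keys t"
  have A: "finite ?A" by simp
  show ?thesis
    unfolding induced_hom_superset [OF A keys_add] induced_hom_superset [OF A Un_upper1]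
      induced_hom_superset [OF A Un_upper2]
    by (simp add: lookup_add power_add prod.distrib)
qed

lemma induced_hom_single:
  "induced_hom \<pi> (Poly_Mapping.single t c) =
    Const c * (\<Prod>i\<in>Poly_Mapping.keys t. Var (\<pi> i) ^ Poly_Mapping.lookup t i)"
  by (simp add: induced_hom_def Const_def)

lemma induced_hom_add: "induced_hom \<pi> (p + q) = induced_hom \<pi> p + induced_hom \<pi> q"
  unfolding induced_hom_def
  by (rule setsum_keys_plus_distrib) (auto simp: Const_def single_add algebra_simps)

lemma mpoly_induct:
  fixes p :: "'k::field mpoly"
  assumes "\<And>t c. P (Poly_Mapping.single t c)" "\<And>p q. P p \<Longrightarrow> P q \<Longrightarrow> P (p + q)"
  shows "P p"
proof (induction p rule: update_induct)
  case const
  then show ?case using assms(1) [of 0 0] by simp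
next
  case (update f a b)
  have "Poly_Mapping.update a b f = f + Poly_Mapping.single a b"
    using update by (intro poly_mapping_eqI)
      (auto simp: lookup_update lookup_add lookup_single in_keys_iff when_def)
  then show ?case using update assms by simp
qed

lemma induced_hom_mult: "induced_hom \<pi> (p * q) = induced_hom \<pi> p * induced_hom \<pi> q"
proof (induction p rule: mpoly_induct)
  case (1 s c)
  show ?case
  proof (induction q rule: mpoly_induct)
    case (1 t d)
    have "Const (c * d) = Const c * Const d"
      by (simp add: Const_def mult_single)
    then show ?case
      by (simp add: mult_single induced_hom_single induced_hom_monom_add mult_ac)
  next
    case (2 p q)
    then show ?case by (simp add: induced_hom_add distrib_left)
  qed
next
  case (2 p q)
  then show ?case by (simp add: induced_hom_add distrib_right)
qed

lemma induced_hom_Var: "induced_hom \<pi> (Var i) = Var (\<pi> i)"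
  by (simp add: Var_def [of i] induced_hom_single Const_def)

lemma induced_hom_Const: "induced_hom \<pi> (Const c) = Const c"
  by (simp add: Const_def [of c] induced_hom_single)

lemma induced_hom_ring_hom:
  assumes "\<pi> \<in> Inc n m"
  shows "induced_hom \<pi> \<in> ring_hom (poly_ring n) (poly_ring m :: 'k::field mpoly ring)"
proof -
  interpret cring "poly_ring m :: 'k mpoly ring"
    by (rule cring_poly_ring)
  let ?C = "carrier (poly_ring m :: 'k mpoly ring)"
  have ring_ops: "p * q \<in> ?C" "p + q \<in> ?C" if "p \<in> ?C" "q \<in> ?C" for p q :: "'k mpoly"
    using m_closed [OF that] a_closed [OF that] by (simp_all add: poly_ring_def)
  have constants: "1 \<in> ?C" "0 \<in> ?C" "Const c \<in> ?C" for c :: 'k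
    by (auto simp: poly_ring_def Const_def)
  have vars: "Var j ^ e \<in> ?C" if "j \<in> {1..m}" for j e
  proof (induction e)
    case (Suc e)
    have "Var j \<in> ?C"
      using that by (auto simp: poly_ring_def Var_def)
    then show ?case
      using Suc ring_ops(1) by simp
  qed (simp add: constants)
  have sums: "sum f A \<in> ?C" if "\<And>x. x \<in> A \<Longrightarrow> f x \<in> ?C"
    for f :: "(nat \<Rightarrow>\<^sub>0 nat) \<Rightarrow> 'k mpoly" and A
    using that by (induction A rule: infinite_finite_induct) (auto simp: ring_ops constants)
  have prods: "prod f A \<in> ?C" if "\<And>x. x \<in> A \<Longrightarrow> f x \<in> ?C"
    for f :: "nat \<Rightarrow> 'k mpoly" and A
    using that by (induction A rule: infinite_finite_induct) (auto simp: ring_ops constants)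
  have \<pi>: "\<pi> i \<in> {1..m}" if "i \<in> {1..n}" for i
    using assms that unfolding Inc_def by (blast dest: PiE_mem)
  have "induced_hom \<pi> p \<in> ?C" if "p \<in> carrier (poly_ring n)" for p :: "'k mpoly"
    using that unfolding induced_hom_def
    by (intro sums ring_ops constants prods vars \<pi>) (force simp: poly_ring_def)
  moreover have "induced_hom \<pi> 1 = (1 :: 'k mpoly)"
    using induced_hom_Const [of \<pi> 1] by (simp add: Const_def)
  ultimately show ?thesis
    by (intro ring_hom_memI) (auto simp: poly_ring_def induced_hom_add induced_hom_mult)
qed

end

theory Submission
  imports Defs "HOL-Algebra.QuotRing"
begin

text \<open>
  Extending an ideal along ring homomorphisms commutes with passing to generators, because the
  preimage of an ideal is an ideal (\<open>genideal_UN_image_genideal\<close>). For a strictly increasing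
  \<open>\<pi>\<close> the image of a generator \<open>x\<^sub>i x\<^sub>j\<close> is again the monomial of a pair, so the extension
  of an edge ideal is the edge ideal of the graph whose edges are the images of the old ones
  (\<open>Inc_ideal_edge_ideal\<close>). The theorem thereby becomes a statement about edges only: the images
  of the edges of \<open>C\<^sub>n\<^sup>c\<close> are exactly the edges of \<open>C\<^sub>m\<^sup>c\<close>, \<open>m = n + r\<close>
  (\<open>cycle_complement_eq_UN_image\<close>).

  An edge of \<open>C\<^sub>m\<^sup>c\<close> is a pair \<open>a < b\<close> in \<open>{1..m}\<close> that is neither consecutive nor equal to
  \<open>{1, m}\<close>. A strictly increasing map does not decrease gaps, and it can only send \<open>{i, j}\<close> to
  \<open>{1, m}\<close> if \<open>{i, j} = {1, n}\<close>, so edges go to edges. Conversely, a pair \<open>i < j\<close> can be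
  sent to \<open>a < b\<close> as soon as there is enough room to the left of \<open>a\<close>, between \<open>a\<close> and \<open>b\<close>,
  and to the right of \<open>b\<close>; given an edge \<open>{a, b}\<close> of \<open>C\<^sub>m\<^sup>c\<close>, a suitable edge
  \<open>{i, j}\<close> of \<open>C\<^sub>n\<^sup>c\<close> can be written down.
\<close>

text \<open>
  For each \<open>h\<close> in \<open>H\<close>, the preimage of the ideal generated by the images of the generators is
  an ideal that contains \<open>S\<close>, hence contains \<open>Idl S\<close>.
\<close>

lemma genideal_UN_image_genideal:
  assumes "ring A" "ring B" and H: "H \<subseteq> ring_hom A B" and S: "S \<subseteq> carrier A"
  shows "Idl\<^bsub>B\<^esub> (\<Union>h\<in>H. h ` (Idl\<^bsub>A\<^esub> S)) = Idl\<^bsub>B\<^esub> (\<Union>h\<in>H. h ` S)"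
proof -
  interpret A: ring A by fact
  interpret B: ring B by fact
  have hc: "h x \<in> carrier B" if "h \<in> H" "x \<in> carrier A" for h x
    using ring_hom_closed [OF subsetD [OF H that(1)] that(2)] .
  have Idl_A: "Idl\<^bsub>A\<^esub> S \<subseteq> carrier A"
    using A.genideal_ideal [OF S] by (simp add: additive_subgroup.a_subset ideal_def)
  have gens: "(\<Union>h\<in>H. h ` S) \<subseteq> carrier B"
    using hc S by blast
  let ?J = "Idl\<^bsub>B\<^esub> (\<Union>h\<in>H. h ` S)"
  have J: "ideal ?J B"
    by (rule B.genideal_ideal [OF gens])
  have "h ` (Idl\<^bsub>A\<^esub> S) \<subseteq> ?J" if h: "h \<in> H" for h
  proof -
    interpret h: ring_hom_ring A B h
      using H h assms by (intro ring_hom_ringI2) auto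
    have "S \<subseteq> {x \<in> carrier A. h x \<in> ?J}"
      using S h B.genideal_self [OF gens] by blast
    then have "Idl\<^bsub>A\<^esub> S \<subseteq> {x \<in> carrier A. h x \<in> ?J}"
      by (rule A.genideal_minimal [OF h.ideal_vimage [OF J]])
    then show ?thesis by blast
  qed
  then have "Idl\<^bsub>B\<^esub> (\<Union>h\<in>H. h ` (Idl\<^bsub>A\<^esub> S)) \<subseteq> ?J"
    by (intro B.genideal_minimal J) blast
  moreover have "?J \<subseteq> Idl\<^bsub>B\<^esub> (\<Union>h\<in>H. h ` (Idl\<^bsub>A\<^esub> S))"
  proof (rule B.genideal_minimal)
    have images: "(\<Union>h\<in>H. h ` (Idl\<^bsub>A\<^esub> S)) \<subseteq> carrier B"
      using hc Idl_A by blast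
    then show "ideal (Idl\<^bsub>B\<^esub> (\<Union>h\<in>H. h ` (Idl\<^bsub>A\<^esub> S))) B"
      by (rule B.genideal_ideal)
    show "(\<Union>h\<in>H. h ` S) \<subseteq> Idl\<^bsub>B\<^esub> (\<Union>h\<in>H. h ` (Idl\<^bsub>A\<^esub> S))"
      using A.genideal_self [OF S] B.genideal_self [OF images] by blast
  qed
  ultimately show ?thesis by blast
qed

text \<open>
  Injectivity of \<open>\<pi>\<close> on \<open>{1..n}\<close> is what lets one recover the edge \<open>e\<close> from
  \<open>\<pi> ` e = {a, b}\<close> as the pair of the preimages of \<open>a\<close> and \<open>b\<close>, so that every generator
  of the edge ideal on the right really is the image of a generator on the left.
\<close>

lemma Inc_ideal_edge_ideal:
  assumes E: "E \<subseteq> Pow {1..n}"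
  shows "Inc_ideal n m (edge_ideal n E :: 'k::field mpoly set)
    = edge_ideal m (\<Union>\<pi>\<in>Inc n m. image \<pi> ` E)"
proof -
  let ?gens = "\<lambda>E. {Var i * Var j | i j. {i, j} \<in> E} :: 'k mpoly set"
  have carrier: "?gens E \<subseteq> carrier (poly_ring n)"
  proof clarify
    fix i j assume "{i, j} \<in> E"
    then have ij: "i \<in> {1..n}" "j \<in> {1..n}"
      using E by auto
    have "Poly_Mapping.keys (Poly_Mapping.single i 1 + Poly_Mapping.single j (1::nat)) \<subseteq> {1..n}"
      using ij keys_add [of "Poly_Mapping.single i (1::nat)" "Poly_Mapping.single j 1"] by auto
    then show "(Var i * Var j :: 'k mpoly) \<in> carrier (poly_ring n)"
      by (simp add: Var_def poly_ring_def mult_single)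
  qed
  have "(\<Union>\<pi>\<in>Inc n m. induced_hom \<pi> ` ?gens E) = ?gens (\<Union>\<pi>\<in>Inc n m. image \<pi> ` E)"
  proof (intro equalityI subsetI)
    fix p assume "p \<in> (\<Union>\<pi>\<in>Inc n m. induced_hom \<pi> ` ?gens E)"
    then obtain \<pi> i j where "\<pi> \<in> Inc n m" "{i, j} \<in> E" "p = induced_hom \<pi> (Var i * Var j)"
      by blast
    moreover from this have "{\<pi> i, \<pi> j} \<in> (\<Union>\<pi>\<in>Inc n m. image \<pi> ` E)"
      by (auto intro!: bexI [of _ \<pi>] rev_image_eqI [of "{i, j}"])
    ultimately show "p \<in> ?gens (\<Union>\<pi>\<in>Inc n m. image \<pi> ` E)"
      by (auto simp: induced_hom_mult induced_hom_Var)
  next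
    fix p assume "p \<in> ?gens (\<Union>\<pi>\<in>Inc n m. image \<pi> ` E)"
    then obtain \<pi> e a b where \<pi>: "\<pi> \<in> Inc n m" and e: "e \<in> E" "{a, b} = \<pi> ` e"
      and p: "p = Var a * Var b"
      by blast
    have "a \<in> \<pi> ` e" "b \<in> \<pi> ` e"
      unfolding e(2) [symmetric] by simp_all
    then obtain i j where ij: "i \<in> e" "j \<in> e" "\<pi> i = a" "\<pi> j = b"
      by (elim imageE) simp
    have "inj_on \<pi> {1..n}"
      using \<pi> by (simp add: Inc_def strict_mono_on_imp_inj_on)
    then have "inj_on \<pi> e"
      by (rule inj_on_subset) (use E e(1) in blast)
    moreover have "\<pi> ` e = \<pi> ` {i, j}" "{i, j} \<subseteq> e"
      using e(2) ij by simp_all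
    ultimately have "e = {i, j}"
      by (metis inj_on_image_eq_iff order_refl)
    moreover have "p = induced_hom \<pi> (Var i * Var j)"
      using p ij by (simp add: induced_hom_mult induced_hom_Var)
    ultimately show "p \<in> (\<Union>\<pi>\<in>Inc n m. induced_hom \<pi> ` ?gens E)"
      using \<pi> e(1) by blast
  qed
  moreover have "Idl\<^bsub>poly_ring m\<^esub> (\<Union>h\<in>induced_hom ` Inc n m. h ` (Idl\<^bsub>poly_ring n\<^esub> ?gens E))
      = Idl\<^bsub>poly_ring m\<^esub> (\<Union>h\<in>induced_hom ` Inc n m. h ` ?gens E)"
    using carrier induced_hom_ring_hom
    by (intro genideal_UN_image_genideal cring.axioms(1) cring_poly_ring) auto
  ultimately show ?thesis
    by (simp add: Inc_ideal_def edge_ideal_def)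
qed

lemma in_cycle_complement_iff:
  assumes "4 \<le> m"
  shows "e \<in> cycle_complement m \<longleftrightarrow>
    (\<exists>i j. e = {i, j} \<and> 1 \<le> i \<and> i + 2 \<le> j \<and> j \<le> m \<and> (1 < i \<or> j < m))"
proof
  assume e: "e \<in> cycle_complement m"
  then have "card e = 2" "e \<subseteq> {1..m}"
    by (simp_all add: cycle_complement_def complement_edges_def)
  then obtain i j where ij: "e = {i, j}" "1 \<le> i" "i < j" "j \<le> m"
  proof -
    obtain x y where "e = {x, y}" "x \<noteq> y"
      using \<open>card e = 2\<close> unfolding card_2_iff by blast
    with \<open>e \<subseteq> {1..m}\<close> show thesis
      using that [of x y] that [of y x]
      by (cases x y rule: linorder_cases) (simp_all add: insert_commute)
  qed
  with e cycle_complement_iff [OF assms, of i j] have "2 \<le> j - i" "j - i \<le> m - 2"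
    by auto
  then have "i + 2 \<le> j" "1 < i \<or> j < m"
    using ij assms by linarith+
  with ij show "\<exists>i j. e = {i, j} \<and> 1 \<le> i \<and> i + 2 \<le> j \<and> j \<le> m \<and> (1 < i \<or> j < m)"
    by blast
next
  assume "\<exists>i j. e = {i, j} \<and> 1 \<le> i \<and> i + 2 \<le> j \<and> j \<le> m \<and> (1 < i \<or> j < m)"
  then obtain i j where "e = {i, j}" "1 \<le> i" "i + 2 \<le> j" "j \<le> m" "1 < i \<or> j < m"
    by blast
  then show "e \<in> cycle_complement m"
    using cycle_complement_iff [OF assms, of i j] by auto
qed

text \<open>
  The three inequalities on gaps are the only obstructions. The map is the translation by
  \<open>0\<close> before \<open>i\<close>, by \<open>a - i\<close> from \<open>i\<close> to \<open>j - 1\<close>, and by \<open>b - j\<close> from \<open>j\<close> on; they say that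
  these shifts are nondecreasing and that \<open>n\<close> does not leave \<open>{1..m}\<close>.
\<close>

lemma Inc_interpolate:
  assumes "1 \<le> i" "i < j" "j \<le> n"
    and left: "i \<le> a" and between: "a + j \<le> b + i" and right: "b + n \<le> m + j"
  obtains \<pi> where "\<pi> \<in> Inc n m" "\<pi> i = a" "\<pi> j = b"
proof
  let ?\<pi> = "restrict (\<lambda>k. if k < i then k else if k < j then a + (k - i) else b + (k - j)) {1..n}"
  show "?\<pi> \<in> Inc n m"
    using assms by (auto simp: Inc_def strict_mono_on_def)
  show "?\<pi> i = a" "?\<pi> j = b"
    using assms by auto
qed

lemma Inc_diff_le:
  assumes "\<pi> \<in> Inc n m" "1 \<le> i" "i \<le> j" "j \<le> n"
  shows "\<pi> i + (j - i) \<le> \<pi> j"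
  using \<open>i \<le> j\<close> \<open>j \<le> n\<close>
proof (induction j rule: dec_induct)
  case (step k)
  have "strict_mono_on {1..n} \<pi>"
    using assms(1) by (simp add: Inc_def)
  then have "\<pi> k < \<pi> (Suc k)"
    by (rule strict_mono_onD) (use assms(2) step in auto)
  with step show ?case by simp
qed simp

lemma cycle_complement_eq_UN_image:
  assumes n: "4 \<le> n" "n \<le> m"
  shows "cycle_complement m = (\<Union>\<pi>\<in>Inc n m. image \<pi> ` cycle_complement n)"
proof (intro equalityI subsetI)
  fix e assume "e \<in> cycle_complement m"
  then obtain a b where e: "e = {a, b}"
    and ab: "1 \<le> a" "a + 2 \<le> b" "b \<le> m" "1 < a \<or> b < m"
    using in_cycle_complement_iff [of m] n by auto
  \<comment> \<open>\<open>i\<close> is as large as \<open>i \<le> a\<close> and \<open>i + 2 \<le> n\<close> permit, and then \<open>j\<close> as small as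
    nonadjacency and the room \<open>m - b\<close> to the right of \<open>b\<close> permit; this keeps the gap
    \<open>j - i\<close> at most \<open>b - a\<close>.\<close>
  define i where "i = min a (n - 2)"
  define j where "j = max (i + 2) (n + b - m)"
  have ij: "1 \<le> i" "i + 2 \<le> j" "j \<le> n" "1 < i \<or> j < n"
    and room: "i \<le> a" "a + j \<le> b + i" "b + n \<le> m + j"
    using ab n unfolding j_def i_def by linarith+
  then obtain \<pi> where \<pi>: "\<pi> \<in> Inc n m" "\<pi> i = a" "\<pi> j = b"
    using Inc_interpolate [of i j n a b m] by auto
  have "{i, j} \<in> cycle_complement n"
    using ij in_cycle_complement_iff [of n] n by blast
  moreover have "e = \<pi> ` {i, j}"
    using e \<pi> by simp
  ultimately show "e \<in> (\<Union>\<pi>\<in>Inc n m. image \<pi> ` cycle_complement n)"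
    using \<pi>(1) by blast
next
  fix e assume "e \<in> (\<Union>\<pi>\<in>Inc n m. image \<pi> ` cycle_complement n)"
  then obtain \<pi> i j where \<pi>: "\<pi> \<in> Inc n m" and e: "e = {\<pi> i, \<pi> j}"
    and ij: "1 \<le> i" "i + 2 \<le> j" "j \<le> n" "1 < i \<or> j < n"
    using in_cycle_complement_iff [of n] n by auto
  have range: "\<pi> k \<in> {1..m}" if "1 \<le> k" "k \<le> n" for k
    using \<pi> that by (auto simp: Inc_def dest!: PiE_mem [of \<pi> _ _ k])
  have "\<pi> i + (j - i) \<le> \<pi> j"
    using Inc_diff_le [OF \<pi>] ij by simp
  moreover have "\<pi> 1 + (i - 1) \<le> \<pi> i" "\<pi> j + (n - j) \<le> \<pi> n"
    using Inc_diff_le [OF \<pi>] ij by simp_all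
  moreover have "1 \<le> \<pi> 1" "\<pi> n \<le> m" "1 \<le> \<pi> i" "\<pi> j \<le> m"
    using range [of 1] range [of n] range [of i] range [of j] ij by auto
  ultimately have "1 \<le> \<pi> i" "\<pi> i + 2 \<le> \<pi> j" "\<pi> j \<le> m" "1 < \<pi> i \<or> \<pi> j < m"
    using ij by linarith+
  then show "e \<in> cycle_complement m"
    using e in_cycle_complement_iff [of m] n by auto
qed

theorem lemma3p17:
  fixes n r :: nat
  assumes "n \<ge> 4"
  shows "Inc_ideal n (n + r) (edge_ideal n (cycle_complement n) :: 'k::field mpoly set)
    = edge_ideal (n + r) (cycle_complement (n + r))"
proof -
  have "cycle_complement n \<subseteq> Pow {1..n}"
    by (auto simp: cycle_complement_def complement_edges_def)
  then show ?thesis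
    using Inc_ideal_edge_ideal [of "cycle_complement n" n "n + r"]
      cycle_complement_eq_UN_image [OF assms, of "n + r"]
    by simp
qed

end
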